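(* Let $R$ be a commutative ring with connected prime spectrum and only finitely many minimal primes. Suppose $R/\mathfrak{p}$ is unit-additive for all minimal primes $\mathfrak{p}$ of $R$. Then $R$ is unit-additive.
   Context: Rings are commutative with identity. A ring is unit-additive if for all units $u,v$ of the ring, $u+v$ is a unit or nilpotent (the zero ring is unit-additive). *)

theory Defs
  imports "HOL-Algebra.QuotRing" "HOL-Analysis.Abstract_Topology"
begin

definition nilpotent_element :: "('a, 'm) ring_scheme \<Rightarrow> 'a \<Rightarrow> bool" where
  "nilpotent_element R x \<longleftrightarrow> x \<in> carrier R \<and> (\<exists>n::nat. x [^]\<^bsub>R\<^esub> n = \<zero>\<^bsub>R\<^esub>)"

definition unit_additive :: "('a, 'm) ring_scheme \<Rightarrow> bool" where
  "unit_additive R \<longleftrightarrow>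
     (\<forall>u\<in>Units R. \<forall>v\<in>Units R. u \<oplus>\<^bsub>R\<^esub> v \<in> Units R \<or> nilpotent_element R (u \<oplus>\<^bsub>R\<^esub> v))"

definition prime_spectrum :: "('a, 'm) ring_scheme \<Rightarrow> 'a set set" where
  "prime_spectrum R = {P. primeideal P R}"

definition minimal_primes :: "('a, 'm) ring_scheme \<Rightarrow> 'a set set" where
  "minimal_primes R = {P. primeideal P R \<and> (\<forall>Q. primeideal Q R \<and> Q \<subseteq> P \<longrightarrow> Q = P)}"

definition vanishing_set :: "('a, 'm) ring_scheme \<Rightarrow> 'a set \<Rightarrow> 'a set set" where
  "vanishing_set R S = {P \<in> prime_spectrum R. S \<subseteq> P}"

definition zariski_topology :: "('a, 'm) ring_scheme \<Rightarrow> 'a set topology" where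
  "zariski_topology R =
     topology (\<lambda>U. \<exists>S\<subseteq>carrier R. U = prime_spectrum R - vanishing_set R S)"

text \<open>The function \<open>topology\<close> is meaningful only on predicates satisfying \<open>istopology\<close>.\<close>

lemma istopology_zariski:
  fixes R (structure)
  assumes "cring R"
  shows "istopology (\<lambda>U. \<exists>S\<subseteq>carrier R. U = prime_spectrum R - vanishing_set R S)"
proof -
  interpret cring R by fact
  let ?O = "\<lambda>U. \<exists>S\<subseteq>carrier R. U = prime_spectrum R - vanishing_set R S"
  have inter: "?O (U \<inter> V)" if "?O U" "?O V" for U V
  proof -
    from that obtain S T where S: "S \<subseteq> carrier R" "U = prime_spectrum R - vanishing_set R S"
      and T: "T \<subseteq> carrier R" "V = prime_spectrum R - vanishing_set R T" by blast
    define W where "W = {s \<otimes> t | s t. s \<in> S \<and> t \<in> T}"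
    have W: "W \<subseteq> carrier R" using S(1) T(1) by (auto simp: W_def)
    have "W \<subseteq> P \<longleftrightarrow> S \<subseteq> P \<or> T \<subseteq> P" if P: "primeideal P R" for P
    proof
      interpret P: primeideal P R by fact
      assume WP: "W \<subseteq> P"
      show "S \<subseteq> P \<or> T \<subseteq> P"
      proof (rule ccontr)
        assume "\<not> (S \<subseteq> P \<or> T \<subseteq> P)"
        then obtain s t where st: "s \<in> S" "s \<notin> P" "t \<in> T" "t \<notin> P" by blast
        then have "s \<otimes> t \<in> P" using WP by (auto simp: W_def)
        with st S(1) T(1) P.I_prime show False by blast
      qed
    next
      interpret P: primeideal P R by fact
      assume "S \<subseteq> P \<or> T \<subseteq> P"
      then show "W \<subseteq> P"
        unfolding W_def using S(1) T(1) P.I_l_closed P.I_r_closed by blast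
    qed
    then have "U \<inter> V = prime_spectrum R - vanishing_set R W"
      using S(2) T(2) by (auto simp: prime_spectrum_def vanishing_set_def)
    with W show ?thesis by blast
  qed
  have union: "?O (\<Union>\<K>)" if K: "\<forall>U\<in>\<K>. ?O U" for \<K>
  proof -
    from K obtain f where f: "\<forall>U\<in>\<K>. f U \<subseteq> carrier R \<and> U = prime_spectrum R - vanishing_set R (f U)"
      by (meson bchoice)
    have eq: "P \<in> U \<longleftrightarrow> P \<in> prime_spectrum R \<and> \<not> f U \<subseteq> P" if "U \<in> \<K>" for P U
    proof -
      have "U = prime_spectrum R - vanishing_set R (f U)" using f that by blast
      then have "P \<in> U \<longleftrightarrow> P \<in> prime_spectrum R - vanishing_set R (f U)" by (rule arg_cong)
      then show ?thesis unfolding vanishing_set_def by blast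
    qed
    have "\<Union>\<K> = prime_spectrum R - vanishing_set R (\<Union>U\<in>\<K>. f U)"
      unfolding vanishing_set_def using eq by blast
    moreover have "(\<Union>U\<in>\<K>. f U) \<subseteq> carrier R" using f by blast
    ultimately show ?thesis by blast
  qed
  show ?thesis unfolding istopology_def
  proof (intro conjI allI impI)
    show "?O (U \<inter> V)" if "?O U" "?O V" for U V using that by (rule inter)
    show "?O (\<Union>\<K>)" if "\<forall>U\<in>\<K>. ?O U" for \<K> using that by (rule union)
  qed
qed

lemma openin_zariski_topology:
  assumes "cring R"
  shows "openin (zariski_topology R) U \<longleftrightarrow>
    (\<exists>S\<subseteq>carrier R. U = prime_spectrum R - vanishing_set R S)"
  unfolding zariski_topology_def
  using topology_inverse'[OF istopology_zariski[OF assms]] by simp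

lemma topspace_zariski_topology:
  fixes R (structure)
  assumes "cring R"
  shows "topspace (zariski_topology R) = prime_spectrum R"
proof -
  interpret cring R by fact
  have "vanishing_set R (carrier R) = {}"
    by (auto simp: vanishing_set_def prime_spectrum_def primeideal_def primeideal_axioms_def
        dest: ideal.Icarr)
  then have "openin (zariski_topology R) (prime_spectrum R)"
    unfolding openin_zariski_topology[OF assms] by (intro exI[of _ "carrier R"]) auto
  moreover have "U \<subseteq> prime_spectrum R" if "openin (zariski_topology R) U" for U
    using that unfolding openin_zariski_topology[OF assms] by blast
  ultimately show ?thesis
    by (metis openin_subset openin_topspace subset_antisym)
qed

end

theory Submission
  imports Defs "HOL-Algebra.Ring_Divisibility"
begin

text \<open>
  Let \<open>w\<close> be a sum of two units. Modulo each minimal prime, \<open>w\<close> becomes a unit or zero. Hence a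
  prime avoids \<open>w\<close> iff it contains one of the finitely many minimal primes modulo which \<open>w\<close>
  is a unit, so \<open>V(w)\<close> is open as well as closed. By connectedness \<open>V(w)\<close> is either empty,
  and \<open>w\<close> is a unit, or the whole spectrum, and \<open>w\<close> is nilpotent.
\<close>

text \<open>Zorn's lemma yields an ideal \<open>M\<close> maximal among those that contain
  \<open>I\<close> and miss the multiplicative set \<open>S\<close>, and such an \<open>M\<close> is
  prime. Two instances matter below: \<open>S\<close> equal to \<open>{\<one>}\<close> and
  \<open>S\<close> the set of powers of an element.\<close>

lemma (in cring) ex_prime_avoiding:
  assumes I: "ideal I R"
    and S: "\<one> \<in> S" "\<And>s t. s \<in> S \<Longrightarrow> t \<in> S \<Longrightarrow> s \<otimes> t \<in> S"
    and disj: "I \<inter> S = {}"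
  shows "\<exists>P. primeideal P R \<and> I \<subseteq> P \<and> P \<inter> S = {}"
proof -
  let ?A = "{J. ideal J R \<and> I \<subseteq> J \<and> J \<inter> S = {}}"
  have "\<exists>M\<in>?A. \<forall>X\<in>?A. M \<subseteq> X \<longrightarrow> X = M"
  proof (rule subset_Zorn_nonempty)
    show "?A \<noteq> {}" using I disj by blast
  next
    fix C assume C: "C \<noteq> {}" "subset.chain ?A C"
    then have "C \<subseteq> ?A" by (simp add: pred_on.chain_def)
    moreover have "subset.chain {J. ideal J R} C"
      using C(2) by (auto simp: pred_on.chain_def)
    then have "ideal (\<Union>C) R"
      using chain_Union_is_ideal[of C] C(1) by simp
    ultimately show "\<Union>C \<in> ?A" using C(1) by blast
  qed
  then obtain M where M: "M \<in> ?A" and max': "\<forall>X\<in>?A. M \<subseteq> X \<longrightarrow> X = M" ..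
  then have M: "ideal M R" "I \<subseteq> M" "M \<inter> S = {}" by simp_all
  have max: "J = M" if "ideal J R" "M \<subseteq> J" "J \<inter> S = {}" for J
    using max' M(2) that by blast
  interpret M: ideal M R by fact
  \<comment> \<open>By maximality, the strictly larger ideal \<open>M + (a)\<close> cannot miss
    \<open>S\<close>.\<close>
  have meet: "\<exists>m\<in>M. \<exists>r\<in>carrier R. m \<oplus> r \<otimes> a \<in> S" if a: "a \<in> carrier R" "a \<notin> M" for a
  proof -
    let ?J = "M <+>\<^bsub>R\<^esub> PIdl a"
    have J: "ideal ?J R"
      by (intro add_ideals M.is_ideal cgenideal_ideal a)
    have eq: "?J = {m \<oplus> r \<otimes> a | m r. m \<in> M \<and> r \<in> carrier R}"
      by (auto simp: set_add_def' cgenideal_def)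
    have "m = m \<oplus> \<zero> \<otimes> a" if "m \<in> M" for m
      using that a(1) by simp
    then have "M \<subseteq> ?J" unfolding eq by blast
    moreover have "a = \<zero> \<oplus> \<one> \<otimes> a" using a(1) by simp
    then have "a \<in> ?J" unfolding eq using M.zero_closed by blast
    ultimately have "?J \<inter> S \<noteq> {}" using max[OF J] a(2) by blast
    then show ?thesis unfolding eq by blast
  qed
  have "primeideal M R"
  proof (rule primeidealI[OF M.is_ideal is_cring])
    show "carrier R \<noteq> M" using S(1) M(3) by blast
  next
    fix a b assume a: "a \<in> carrier R" and b: "b \<in> carrier R" and ab: "a \<otimes> b \<in> M"
    show "a \<in> M \<or> b \<in> M"
    proof (rule ccontr)
      assume "\<not> (a \<in> M \<or> b \<in> M)"
      then obtain m r n t where *: "m \<in> M" "r \<in> carrier R" "m \<oplus> r \<otimes> a \<in> S"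
        "n \<in> M" "t \<in> carrier R" "n \<oplus> t \<otimes> b \<in> S"
        using meet a b by metis
      have c: "m \<in> carrier R" "n \<in> carrier R" using *(1,4) M.Icarr by auto
      \<comment> \<open>Each summand has a factor \<open>m\<close>, \<open>n\<close> or
        \<open>a \<otimes> b\<close>, all of which lie in \<open>M\<close>. So the product of two
        elements of \<open>S\<close> lands in \<open>M\<close>, which is disjoint from
        \<open>S\<close>.\<close>
      have "(m \<oplus> r \<otimes> a) \<otimes> (n \<oplus> t \<otimes> b)
          = (m \<otimes> (n \<oplus> t \<otimes> b) \<oplus> (r \<otimes> a) \<otimes> n) \<oplus> (r \<otimes> t) \<otimes> (a \<otimes> b)"
        using a b c *(2,5) by algebra
      moreover have "m \<otimes> (n \<oplus> t \<otimes> b) \<in> M" "(r \<otimes> a) \<otimes> n \<in> M" "(r \<otimes> t) \<otimes> (a \<otimes> b) \<in> M"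
        using a b c *(1,2,4,5) ab by (simp_all add: M.I_l_closed M.I_r_closed)
      ultimately have "(m \<oplus> r \<otimes> a) \<otimes> (n \<oplus> t \<otimes> b) \<in> M" by simp
      then show False using S(2)[OF *(3,6)] M(3) by blast
    qed
  qed
  then show ?thesis using M by blast
qed

text \<open>A proper principal ideal misses \<open>{\<one>}\<close>, so it would lie in a
  prime.\<close>

lemma (in cring) unit_if_in_no_prime:
  assumes w: "w \<in> carrier R" and none: "\<And>P. primeideal P R \<Longrightarrow> w \<notin> P"
  shows "w \<in> Units R"
proof -
  have "\<one> \<in> PIdl w"
  proof (rule ccontr)
    assume "\<one> \<notin> PIdl w"
    then obtain P where "primeideal P R" "PIdl w \<subseteq> P"
      using ex_prime_avoiding[OF cgenideal_ideal[OF w], of "{\<one>}"] by auto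
    then show False using none cgenideal_self[OF w] by blast
  qed
  then obtain x where "x \<in> carrier R" "\<one> = x \<otimes> w"
    by (auto simp: cgenideal_def)
  then show ?thesis using w m_comm unfolding Units_def by force
qed

text \<open>If no power of \<open>w\<close> vanishes, the zero ideal misses the multiplicative set
  of powers of \<open>w\<close>, so some prime avoids all of them, in particular \<open>w\<close>
  itself.\<close>

lemma (in cring) nilpotent_if_in_all_primes:
  assumes w: "w \<in> carrier R" and all: "\<And>P. primeideal P R \<Longrightarrow> w \<in> P"
  shows "nilpotent_element R w"
proof (rule ccontr)
  assume "\<not> nilpotent_element R w"
  then have nz: "w [^] n \<noteq> \<zero>" for n :: nat
    using w by (auto simp: nilpotent_element_def)
  let ?S = "range (\<lambda>n::nat. w [^] n)"
  have "\<exists>P. primeideal P R \<and> {\<zero>} \<subseteq> P \<and> P \<inter> ?S = {}"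
  proof (rule ex_prime_avoiding[OF zeroideal])
    show "\<one> \<in> ?S" by (rule range_eqI[of _ _ 0]) simp
    show "s \<otimes> t \<in> ?S" if "s \<in> ?S" "t \<in> ?S" for s t
      using that w by (auto simp: nat_pow_mult)
    show "{\<zero>} \<inter> ?S = {}" using nz by force
  qed
  moreover have "w \<in> ?S" by (rule range_eqI[of _ _ 1]) (simp add: w)
  ultimately show False using all by blast
qed

text \<open>If \<open>P\<close> misses \<open>a\<close> and \<open>Q\<close> misses
  \<open>b\<close>, the smaller of the two primes misses both, although it contains the product.
  This supplies the lower bounds for finding minimal primes by Zorn's lemma.\<close>

lemma (in cring) primeideal_Inter_chain:
  assumes ne: "C \<noteq> {}" and prime: "\<And>P. P \<in> C \<Longrightarrow> primeideal P R"
    and chain: "\<And>P Q. P \<in> C \<Longrightarrow> Q \<in> C \<Longrightarrow> P \<subseteq> Q \<or> Q \<subseteq> P"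
  shows "primeideal (\<Inter>C) R"
proof (rule primeidealI)
  show "ideal (\<Inter>C) R"
    using ne prime by (intro i_Intersect) (auto simp: primeideal_def)
  show "cring R" by (rule is_cring)
  obtain P where "P \<in> C" using ne by blast
  then interpret P: primeideal P R by (rule prime)
  have "\<one> \<notin> P" using P.I_notcarr P.one_imp_carrier by blast
  then show "carrier R \<noteq> \<Inter>C" using \<open>P \<in> C\<close> by blast
next
  fix a b assume a: "a \<in> carrier R" and b: "b \<in> carrier R" and ab: "a \<otimes> b \<in> \<Inter>C"
  show "a \<in> \<Inter>C \<or> b \<in> \<Inter>C"
  proof (rule ccontr)
    assume "\<not> (a \<in> \<Inter>C \<or> b \<in> \<Inter>C)"
    then obtain P Q where *: "P \<in> C" "a \<notin> P" "Q \<in> C" "b \<notin> Q" by blast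
    then obtain L where "L \<in> C" "a \<notin> L" "b \<notin> L"
      using chain[of P Q] by blast
    then show False using primeideal.I_prime[OF prime a b] ab by blast
  qed
qed

lemma (in cring) ex_minimal_prime_below:
  assumes P: "primeideal P R"
  shows "\<exists>Q\<in>minimal_primes R. Q \<subseteq> P"
proof -
  \<comment> \<open>Zorn's lemma is available here for maximal sets, so it is applied to
    complements: a maximal complement belongs to a minimal prime, and unions of chains become
    intersections.\<close>
  let ?A = "uminus ` {Q. primeideal Q R \<and> Q \<subseteq> P}"
  have "\<exists>M\<in>?A. \<forall>X\<in>?A. M \<subseteq> X \<longrightarrow> X = M"
  proof (rule subset_Zorn_nonempty)
    show "?A \<noteq> {}" using P by blast
  next
    fix C assume C: "C \<noteq> {}" "subset.chain ?A C"
    let ?D = "uminus ` C"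
    have D: "primeideal Q R \<and> Q \<subseteq> P" if "Q \<in> ?D" for Q
      using C(2) that by (fastforce simp: pred_on.chain_def)
    have "primeideal (\<Inter>?D) R"
    proof (rule primeideal_Inter_chain)
      show "?D \<noteq> {}" using C(1) by blast
      show "primeideal Q R" if "Q \<in> ?D" for Q using D that by blast
      have "X \<subseteq> Y \<or> Y \<subseteq> X" if "X \<in> C" "Y \<in> C" for X Y
        using C(2) that unfolding subset_chain_def by blast
      then show "Q \<subseteq> Q' \<or> Q' \<subseteq> Q" if "Q \<in> ?D" "Q' \<in> ?D" for Q Q'
        using that by (metis Compl_subset_Compl_iff imageE)
    qed
    moreover have "\<Inter>?D \<subseteq> P" using C(1) D by blast
    moreover have "\<Union>C = - \<Inter>?D" by auto
    ultimately show "\<Union>C \<in> ?A" by blast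
  qed
  then obtain M where "M \<in> ?A" and max': "\<forall>X\<in>?A. M \<subseteq> X \<longrightarrow> X = M" ..
  then obtain Q where Q: "primeideal Q R" "Q \<subseteq> P" and M: "M = - Q" by blast
  have max: "\<forall>X\<in>?A. - Q \<subseteq> X \<longrightarrow> X = - Q" using max' M by simp
  have "Q' = Q" if "primeideal Q' R" "Q' \<subseteq> Q" for Q'
  proof -
    have "- Q' \<in> ?A" using that Q(2) by blast
    moreover have "- Q \<subseteq> - Q'" using that(2) by blast
    ultimately have "- Q' = - Q" using max by blast
    then show ?thesis by simp
  qed
  then show ?thesis using Q unfolding minimal_primes_def by blast
qed

lemma (in ring_hom_ring) Units_image:
  assumes "u \<in> Units R"
  shows "h u \<in> Units S"
proof -
  obtain x where "u \<in> carrier R" "x \<in> carrier R" "x \<otimes>\<^bsub>R\<^esub> u = \<one>\<^bsub>R\<^esub>" "u \<otimes>\<^bsub>R\<^esub> x = \<one>\<^bsub>R\<^esub>"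
    using assms unfolding Units_def by blast
  then have "h x \<otimes>\<^bsub>S\<^esub> h u = \<one>\<^bsub>S\<^esub>" "h u \<otimes>\<^bsub>S\<^esub> h x = \<one>\<^bsub>S\<^esub>" "h x \<in> carrier S" "h u \<in> carrier S"
    by (metis hom_mult hom_one, metis hom_mult hom_one, auto)
  then show ?thesis unfolding Units_def by blast
qed

lemma (in ideal) quotient_eq_zero_iff:
  assumes "x \<in> carrier R"
  shows "I +> x = \<zero>\<^bsub>R Quot I\<^esub> \<longleftrightarrow> x \<in> I"
  using assms rcos_const_imp_mem a_rcos_zero[OF is_ideal] by (auto simp: FactRing_def)

lemma (in primeideal) nilpotent_quotient:
  assumes "x \<in> carrier R" "nilpotent_element (R Quot I) (I +> x)"
  shows "x \<in> I"
proof -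
  interpret h: ring_hom_ring R "R Quot I" "(+>) I" by (rule rcos_ring_hom_ring)
  interpret Q: domain "R Quot I" by (rule quotient_is_domain)
  obtain n :: nat where "(I +> x) [^]\<^bsub>R Quot I\<^esub> n = \<zero>\<^bsub>R Quot I\<^esub>"
    using assms(2) unfolding nilpotent_element_def by blast
  then have "I +> x = \<zero>\<^bsub>R Quot I\<^esub>"
  proof (induction n)
    \<comment> \<open>Exponent 0 is allowed in \<open>nilpotent_element\<close>, but it would give
      one equal to zero, which is impossible in a domain.\<close>
    case 0
    then show ?case by simp
  next
    case (Suc n)
    then show ?case using assms(1) Q.integral_iff by auto
  qed
  then show ?thesis using quotient_eq_zero_iff assms(1) by blast
qed

text \<open>If \<open>x\<close> inverts \<open>w\<close> modulo \<open>I\<close>, then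
  \<open>\<one> \<ominus> w \<otimes> x\<close> lies in \<open>I\<close> and hence in
  \<open>J\<close>, as does \<open>w \<otimes> x\<close>; their sum is \<open>\<one>\<close>.
  Consequently no prime above \<open>I\<close> contains \<open>w\<close>.\<close>

lemma (in ideal) quotient_unit_imp_comaximal:
  assumes w: "w \<in> carrier R" "I +> w \<in> Units (R Quot I)"
    and J: "ideal J R" "I \<subseteq> J" "w \<in> J"
  shows "J = carrier R"
proof -
  interpret h: ring_hom_ring R "R Quot I" "(+>) I" by (rule rcos_ring_hom_ring)
  interpret J: ideal J R by fact
  obtain X where X: "X \<in> carrier (R Quot I)" "(I +> w) \<otimes>\<^bsub>R Quot I\<^esub> X = \<one>\<^bsub>R Quot I\<^esub>"
    using w(2) unfolding Units_def by blast
  then obtain x where x: "x \<in> carrier R" "X = I +> x"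
    unfolding FactRing_simps by auto
  have "I +> (w \<otimes> x) = I +> \<one>"
    using X(2) unfolding x(2) h.hom_mult[OF w(1) x(1), symmetric] h.hom_one[symmetric] .
  then have "\<one> \<ominus> w \<otimes> x \<in> I"
    using quotient_eq_iff_same_a_r_cos[OF is_ideal, of \<one> "w \<otimes> x"] w(1) x(1) by simp
  then have "(\<one> \<ominus> w \<otimes> x) \<oplus> w \<otimes> x \<in> J"
    using J x(1) by (intro J.a_closed J.I_r_closed) auto
  moreover have "(\<one> \<ominus> w \<otimes> x) \<oplus> w \<otimes> x = \<one>"
    using w(1) x(1) by (simp add: minus_eq a_assoc l_neg)
  ultimately show ?thesis using J.one_imp_carrier by simp
qed

lemma openin_zariski_nonvanishing:
  assumes "cring R" "S \<subseteq> carrier R"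
  shows "openin (zariski_topology R) (prime_spectrum R - vanishing_set R S)"
  using assms openin_zariski_topology by blast

lemma closedin_zariski_vanishing:
  assumes "cring R" "S \<subseteq> carrier R"
  shows "closedin (zariski_topology R) (vanishing_set R S)"
  using openin_zariski_nonvanishing[OF assms] topspace_zariski_topology[OF assms(1)]
  unfolding closedin_def vanishing_set_def by auto

theorem proposition6p1:
  fixes R :: "('a, 'm) ring_scheme" (structure)
  assumes "cring R"
    and "connected_space (zariski_topology R)"
    and "finite (minimal_primes R)"
    and "\<And>P. P \<in> minimal_primes R \<Longrightarrow> unit_additive (R Quot P)"
  shows "unit_additive R"
  unfolding unit_additive_def
proof (intro ballI)
  fix u v assume u: "u \<in> Units R" and v: "v \<in> Units R"
  interpret cring R by fact
  define w where "w = u \<oplus> v"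
  have w: "w \<in> carrier R" using u v by (simp add: w_def Units_closed)
  define B where "B = {P \<in> minimal_primes R. P +> w \<in> Units (R Quot P)}"
  \<comment> \<open>The images of \<open>u\<close> and \<open>v\<close> are units of
    \<open>R Quot P\<close>, so the image of \<open>w\<close> is a unit or nilpotent; in this domain
    nilpotent means zero.\<close>
  have unit_or_mem: "P \<in> B \<or> w \<in> P" if P: "P \<in> minimal_primes R" for P
  proof -
    interpret P: primeideal P R using P by (simp add: minimal_primes_def)
    interpret h: ring_hom_ring R "R Quot P" "(+>) P" by (rule P.rcos_ring_hom_ring)
    have "P +> w = (P +> u) \<oplus>\<^bsub>R Quot P\<^esub> (P +> v)"
      using u v by (simp add: w_def Units_closed)
    then have "P +> w \<in> Units (R Quot P) \<or> nilpotent_element (R Quot P) (P +> w)"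
      using assms(4)[OF P] h.Units_image[OF u] h.Units_image[OF v]
      unfolding unit_additive_def by simp
    then show ?thesis using P.nilpotent_quotient[OF w] P by (auto simp: B_def)
  qed
  have "prime_spectrum R - vanishing_set R {w} = (\<Union>P\<in>B. vanishing_set R P)"
  proof (rule subset_antisym; rule subsetI)
    fix Q assume Q: "Q \<in> prime_spectrum R - vanishing_set R {w}"
    \<comment> \<open>As \<open>w\<close> is not in \<open>Q\<close>, it is not in the smaller
      \<open>P\<close> either, so \<open>unit_or_mem\<close> puts \<open>P\<close> into
      \<open>B\<close>.\<close>
    then obtain P where "P \<in> minimal_primes R" "P \<subseteq> Q"
      using ex_minimal_prime_below unfolding prime_spectrum_def by blast
    then show "Q \<in> (\<Union>P\<in>B. vanishing_set R P)"
      using unit_or_mem Q by (auto simp: vanishing_set_def)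
  next
    fix Q assume "Q \<in> (\<Union>P\<in>B. vanishing_set R P)"
    then obtain P where P: "P \<in> B" "P \<subseteq> Q" and Q: "primeideal Q R"
      by (auto simp: vanishing_set_def prime_spectrum_def)
    interpret P: primeideal P R using P(1) by (simp add: B_def minimal_primes_def)
    \<comment> \<open>Otherwise \<open>Q\<close> would contain both \<open>P\<close> and an element
      invertible modulo \<open>P\<close>, and so be the whole ring.\<close>
    have "w \<notin> Q"
      using P.quotient_unit_imp_comaximal[OF w _ _ P(2)] P(1) Q
      by (auto simp: B_def primeideal_def primeideal_axioms_def)
    then show "Q \<in> prime_spectrum R - vanishing_set R {w}"
      using Q by (simp add: vanishing_set_def prime_spectrum_def)
  qed
  \<comment> \<open>Finiteness of the set of minimal primes enters here: only a finite union of
    closed sets is sure to be closed.\<close>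
  moreover have "closedin (zariski_topology R) (\<Union>P\<in>B. vanishing_set R P)"
  proof (rule closedin_Union)
    show "finite (vanishing_set R ` B)" using assms(3) by (simp add: B_def)
    show "closedin (zariski_topology R) V" if "V \<in> vanishing_set R ` B" for V
      using that closedin_zariski_vanishing[OF assms(1)]
      by (auto simp: B_def minimal_primes_def primeideal_def dest: ideal.Icarr)
  qed
  ultimately have "closedin (zariski_topology R) (prime_spectrum R - vanishing_set R {w})"
    by simp
  moreover have "openin (zariski_topology R) (prime_spectrum R - vanishing_set R {w})"
    using openin_zariski_nonvanishing[OF assms(1)] w by simp
  ultimately have "prime_spectrum R - vanishing_set R {w} = {} \<or>
      prime_spectrum R - vanishing_set R {w} = prime_spectrum R"
    using assms(2) unfolding connected_space_clopen_in topspace_zariski_topology[OF assms(1)]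
    by blast
  \<comment> \<open>The alternatives may overlap: the zero ring has an empty spectrum, which counts
    as connected, and then both hold.\<close>
  then consider "\<And>P. primeideal P R \<Longrightarrow> w \<in> P" | "\<And>P. primeideal P R \<Longrightarrow> w \<notin> P"
    by (force simp: vanishing_set_def prime_spectrum_def)
  then show "u \<oplus> v \<in> Units R \<or> nilpotent_element R (u \<oplus> v)"
    unfolding w_def[symmetric]
    using nilpotent_if_in_all_primes[OF w] unit_if_in_no_prime[OF w] by metis
qed

end
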